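(* Let $m,n$ be positive integers with $$n>2(2\sqrt{2m}+1)^2,$$ let $\{1,\dots,n\}$ be partitioned into disjoint sets $P_+$ and $P_n$, let $\|\cdot\|$ be a norm on $\mathbb{R}^m$, and let $0\le\xi<1$, $\theta\ge 1$, $\sigma\ge 0$, $\rho\ge 0$, a positive integer $s$ and a real $m\times n$ matrix $A$ be such that $A$ satisfies the condition $\mathbf{VSG}_s(\xi,\theta,\rho,\sigma)$. Then $$s\le 2\sqrt{2m}+1.$$
   Context: Definitions (with respect to $s$, $P_+$, $P_n$ and the norm $\|\cdot\|$ on $\mathbb{R}^m$, whose conjugate norm is $\|z\|_*=\max\{z^Tx:\|x\|\le 1\}$). For $x\in\mathbb{R}^n$, $\|x\|_{s,1}=\max\{u^Tx:\ \|u\|_1\le s,\ \|u\|_\infty\le 1\}$ is the sum of the $s$ largest magnitudes of entries of $x$. Given $\xi,\theta$, define $D_\theta[x]\in\mathbb{R}^n$ by $(D_\theta[x])_i=(1+\theta\xi)\max[x_i,0]$ for $i\in P_+$ and $(D_\theta[x])_i=(1+\xi)|x_i|$ for $i\notin P_+$, and set $\Phi_s(x)=\|D_\theta[x]\|_{s,1}$. Condition $\mathbf{VSG}_s(\xi,\theta,\rho,\sigma)$ on $A$: there exist an $m\times n$ matrix $Y=[y_1,\dots,y_n]$ and a vector $v\in\mathbb{R}^m$ such that, with $C_i[Y,A]$ denoting the $i$-th column of the matrix $I-Y^TA$, - $\Phi_s(-C_i[Y,A])+(A^Tv)_i\le\xi$ for $1\le i\le n$; - $\Phi_s(C_i[Y,A])-(A^Tv)_i\le\xi$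 for $i\notin P_+$; - $\Phi_s(C_i[Y,A])-(A^Tv)_i\le\theta\xi$ for $i\in P_+$; - $\|y_i\|_*\le\sigma$ for $1\le i\le n$; - $\|v\|_*\le\rho$. *)

theory Defs
  imports "HOL-Analysis.Analysis"
begin

definition is_norm :: "('a::real_vector \<Rightarrow> real) \<Rightarrow> bool" where
  "is_norm N \<longleftrightarrow>
     (\<forall>x. 0 \<le> N x) \<and>
     (\<forall>x. N x = 0 \<longleftrightarrow> x = 0) \<and>
     (\<forall>c x. N (c *\<^sub>R x) = \<bar>c\<bar> * N x) \<and>
     (\<forall>x y. N (x + y) \<le> N x + N y)"

text \<open>The two maxima below are linear functions maximised over nonempty compact sets
  (for the first one, when N is a norm), so the suprema are attained.\<close>

definition conj_norm :: "('a::real_inner \<Rightarrow> real) \<Rightarrow> 'a \<Rightarrow> real" where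
  "conj_norm N z = Sup {z \<bullet> x | x. N x \<le> 1}"

definition norm_s1 :: "nat \<Rightarrow> real^'n \<Rightarrow> real" where
  "norm_s1 s x =
     Sup {u \<bullet> x | u. (\<Sum>i\<in>UNIV. \<bar>u $ i\<bar>) \<le> real s \<and> infnorm u \<le> 1}"

definition D_op :: "'n set \<Rightarrow> real \<Rightarrow> real \<Rightarrow> real^'n \<Rightarrow> real^'n" where
  "D_op Pp \<xi> \<theta> x =
     (\<chi> i. if i \<in> Pp then (1 + \<theta> * \<xi>) * max (x $ i) 0 else (1 + \<xi>) * \<bar>x $ i\<bar>)"

definition Phi :: "'n set \<Rightarrow> real \<Rightarrow> real \<Rightarrow> nat \<Rightarrow> real^'n \<Rightarrow> real" where
  "Phi Pp \<xi> \<theta> s x = norm_s1 s (D_op Pp \<xi> \<theta> x)"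

text \<open>An m-by-n matrix has type real^'n^'m (the row index is the outer one).\<close>

definition C_col :: "real^'n^'m \<Rightarrow> real^'n^'m \<Rightarrow> 'n \<Rightarrow> real^'n" where
  "C_col Y A i = column i (mat 1 - transpose Y ** A)"

definition VSG ::
  "(real^'m \<Rightarrow> real) \<Rightarrow> 'n set \<Rightarrow> nat \<Rightarrow> real \<Rightarrow> real \<Rightarrow> real \<Rightarrow> real \<Rightarrow> real^'n^'m \<Rightarrow> bool" where
  "VSG N Pp s \<xi> \<theta> \<rho> \<sigma> A \<longleftrightarrow>
     (\<exists>(Y :: real^'n^'m) (v :: real^'m).
        (\<forall>i. Phi Pp \<xi> \<theta> s (- C_col Y A i) + (transpose A *v v) $ i \<le> \<xi>) \<and>
        (\<forall>i. i \<notin> Pp \<longrightarrow> Phi Pp \<xi> \<theta> s (C_col Y A i) - (transpose A *v v) $ i \<le> \<xi>) \<and>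
        (\<forall>i\<in>Pp. Phi Pp \<xi> \<theta> s (C_col Y A i) - (transpose A *v v) $ i \<le> \<theta> * \<xi>) \<and>
        (\<forall>i. conj_norm N (column i Y) \<le> \<sigma>) \<and>
        conj_norm N v \<le> \<rho>)"

end

theory Submission imports Defs begin

text \<open>
  The matrix \<open>M = Y\<^sup>T A\<close> has rank at most \<open>m\<close>, while the condition forces a large principal
  submatrix of it to have a dominant diagonal; a matrix of low rank and large size cannot be
  that close to a diagonal one.

  For a fixed column \<open>i\<close>, the two bounds on \<open>\<Phi>\<^sub>s\<close> at \<open>- C\<^sub>i\<close> and at \<open>C\<^sub>i\<close> contain the unknown
  number \<open>(A\<^sup>T v)\<^sub>i\<close> with opposite signs. Adding them eliminates it, and also merges the positive
  and negative parts on \<open>P\<^sub>+\<close> into absolute values. If row indices are restricted to the class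
  (\<open>P\<^sub>+\<close> or \<open>P\<^sub>n\<close>) containing \<open>i\<close>, the weights cancel favourably because \<open>\<xi> < 1\<close>: any \<open>s\<close> entries
  of \<open>C\<^sub>i\<close> in that class have absolute sum below 1 (\<open>sum_abs_lt_1_of_Phi_bounds\<close>). Let \<open>P\<close> be the
  larger class, so that it has at least \<open>n/2\<close> elements. As \<open>C\<^sub>i = e\<^sub>i - M e\<^sub>i\<close>, in the columns of
  \<open>M\<close> indexed by \<open>P\<close> the diagonal entry exceeds the absolute sum of any \<open>s - 1\<close> off-diagonal
  entries from \<open>P\<close>.

  The diagonal entries may be arbitrarily small, so the columns are first divided by them. The
  normalised \<open>P \<times> P\<close> matrix has trace \<open>|P|\<close>, and each of its columns has squared norm at most
  \<open>2 + |P| / (s - 1)\<^sup>2\<close> (\<open>sum_squares_le_of_top_sums\<close>). The square of a trace is at most the rank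
  times the squared Frobenius norm (\<open>trace_square_le_rank\<close>), so
  \<open>|P| \<le> m (2 + |P| / (s - 1)\<^sup>2)\<close> (\<open>card_le_rank_if_columns_dominated\<close>). If \<open>s - 1 > 2 \<surd>(2m)\<close>,
  this gives \<open>7 |P| \<le> 16 m\<close>, against \<open>|P| \<ge> n/2 > 8 m\<close>.
\<close>

section \<open>Large matrices of low rank\<close>

text \<open>
  Fewer than \<open>k\<close> entries exceed \<open>1/k\<close>, since \<open>k\<close> of them would already sum to more than 1. These
  large entries lie in \<open>[0, 1]\<close>, so their squares sum to at most their own sum; every other entry
  contributes at most \<open>1/k\<^sup>2\<close>.
\<close>

lemma sum_squares_le_of_top_sums:
  fixes b :: "'a \<Rightarrow> real"
  assumes "finite J" "k \<ge> 1" and nonneg: "\<And>j. j \<in> J \<Longrightarrow> 0 \<le> b j"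
    and top: "\<And>T. T \<subseteq> J \<Longrightarrow> card T \<le> k \<Longrightarrow> sum b T \<le> 1"
  shows "(\<Sum>j\<in>J. (b j)\<^sup>2) \<le> 1 + card J / (real k)\<^sup>2"
proof -
  define T where "T = {j \<in> J. b j > 1 / k}"
  have finT: "finite T" and TJ: "T \<subseteq> J"
    using assms(1) by (auto simp: T_def)
  have cardT: "card T \<le> k"
  proof (rule ccontr)
    assume "\<not> card T \<le> k"
    then obtain U where U: "U \<subseteq> T" "card U = k" "finite U"
      using obtain_subset_with_card_n[of k T] by auto
    have "U \<noteq> {}"
      using U(2) \<open>k \<ge> 1\<close> by auto
    have "1 = (\<Sum>j\<in>U. 1 / real k)"
      using U(2) \<open>k \<ge> 1\<close> by simp
    also have "\<dots> < sum b U"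
      using U \<open>U \<noteq> {}\<close> by (intro sum_strict_mono) (auto simp: T_def)
    also have "\<dots> \<le> 1"
      using U TJ by (intro top) auto
    finally show False
      by simp
  qed
  have le1: "b j \<le> 1" if "j \<in> J" for j
    using top[of "{j}"] that \<open>k \<ge> 1\<close> by simp
  have "(\<Sum>j\<in>T. (b j)\<^sup>2) \<le> sum b T"
    using nonneg le1 TJ by (intro sum_mono) (auto simp: power2_eq_square intro!: mult_left_le)
  also have "\<dots> \<le> 1"
    using top TJ cardT by blast
  finally have large: "(\<Sum>j\<in>T. (b j)\<^sup>2) \<le> 1" .
  have "(\<Sum>j\<in>J - T. (b j)\<^sup>2) \<le> (\<Sum>j\<in>J - T. (1 / real k)\<^sup>2)"
    using nonneg by (intro sum_mono power_mono) (auto simp: T_def)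
  also have "\<dots> \<le> card J / (real k)\<^sup>2"
    using card_mono[OF assms(1), of "J - T"]
    by (simp add: power_divide divide_right_mono)
  finally have small: "(\<Sum>j\<in>J - T. (b j)\<^sup>2) \<le> card J / (real k)\<^sup>2" .
  have "(\<Sum>j\<in>J. (b j)\<^sup>2) = (\<Sum>j\<in>J - T. (b j)\<^sup>2) + (\<Sum>j\<in>T. (b j)\<^sup>2)"
    using sum.subset_diff[OF TJ assms(1)] .
  with large small show ?thesis
    by linarith
qed

text \<open>
  If \<open>B\<close> is an orthonormal basis of the column space, the trace is the inner product of the
  coordinates \<open>c\<^sub>i \<bullet> b\<close> of the columns with the entries \<open>b\<^sub>i\<close> of the basis vectors, both families
  indexed by the pairs \<open>(i, b)\<close>. By Parseval the first has squared norm \<open>\<Sum>\<^sub>i |c\<^sub>i|\<^sup>2\<close>; the second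
  has squared norm \<open>|B|\<close>, which is the rank. The claim is the Cauchy-Schwarz inequality.
\<close>

lemma trace_square_le_rank:
  fixes M :: "real^'n^'n"
  shows "(trace M)\<^sup>2 \<le> real (rank M) * (\<Sum>i\<in>UNIV. (norm (column i M))\<^sup>2)"
proof -
  obtain B where B: "pairwise orthogonal B" "\<And>x. x \<in> B \<Longrightarrow> norm x = 1" "independent B"
      "card B = dim (span (columns M))" "span B = span (columns M)"
    using orthonormal_basis_subspace[OF subspace_span, of "columns M"] by metis
  have finB: "finite B"
    using B(3) by (rule independent_imp_finite)
  have cardB: "card B = rank M"
    using B(4) by (simp add: column_rank_def)
  define c where "c i = column i M" for i
  have expand: "(\<Sum>b\<in>B. (c i \<bullet> b) *\<^sub>R b) = c i" for i
  proof -
    have "c i \<in> span B"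
      unfolding B(5) c_def columns_def by (auto intro: span_base)
    then show ?thesis
      using B(1,2) finB by (intro orthonormal_basis_expand) auto
  qed
  have parseval: "(\<Sum>b\<in>B. (c i \<bullet> b)\<^sup>2) = (norm (c i))\<^sup>2" for i
  proof -
    have "(norm (c i))\<^sup>2 = c i \<bullet> (\<Sum>b\<in>B. (c i \<bullet> b) *\<^sub>R b)"
      by (simp add: expand power2_norm_eq_inner)
    then show ?thesis
      by (simp add: inner_sum_right power2_eq_square)
  qed
  have unit: "(\<Sum>i\<in>UNIV. (b $ i)\<^sup>2) = 1" if "b \<in> B" for b
    using B(2)[OF that] by (simp add: norm_vec_def L2_set_def)
  have "M $ i $ i = (\<Sum>b\<in>B. (c i \<bullet> b) * b $ i)" for i
    using arg_cong[OF expand[of i], of "\<lambda>x. x $ i"]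
    by (simp add: c_def column_def)
  then have tr: "trace M = (\<Sum>(i, b)\<in>UNIV \<times> B. (c i \<bullet> b) * b $ i)"
    by (simp add: trace_def sum.cartesian_product)
  have "(trace M)\<^sup>2 \<le> (\<Sum>(i, b)\<in>UNIV \<times> B. (c i \<bullet> b)\<^sup>2) * (\<Sum>(i, b)\<in>UNIV \<times> B. (b $ i)\<^sup>2)"
    unfolding tr using Cauchy_Schwarz_ineq_sum[of "\<lambda>(i, b). c i \<bullet> b" "\<lambda>(i, b). b $ i" "UNIV \<times> B"]
    by (simp add: case_prod_beta)
  also have "(\<Sum>(i, b)\<in>UNIV \<times> B. (c i \<bullet> b)\<^sup>2) = (\<Sum>i\<in>UNIV. (norm (c i))\<^sup>2)"
    by (simp add: sum.cartesian_product[symmetric] parseval)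
  also have "(\<Sum>(i, b)\<in>UNIV \<times> B. (b $ i)\<^sup>2) = (\<Sum>b\<in>B. \<Sum>i\<in>UNIV. (b $ i)\<^sup>2)"
    by (subst sum.swap) (simp add: sum.cartesian_product)
  also have "\<dots> = real (rank M)"
    by (simp add: unit cardB)
  finally show ?thesis
    by (simp add: c_def mult.commute)
qed

text \<open>
  Scaling columns and deleting rows and columns cannot raise the rank, so the trace inequality may
  be applied to the \<open>P \<times> P\<close> part of \<open>M\<close> after dividing each column by its diagonal entry. This
  normalisation makes the bound independent of the size of the diagonal.
\<close>

lemma card_le_rank_if_columns_dominated:
  fixes M :: "real^'n^'n"
  assumes "k \<ge> 1"
    and diag: "\<And>i. i \<in> P \<Longrightarrow> 0 < M $ i $ i"
    and dom: "\<And>i T. i \<in> P \<Longrightarrow> T \<subseteq> P - {i} \<Longrightarrow> card T \<le> k \<Longrightarrow> (\<Sum>j\<in>T. \<bar>M $ j $ i\<bar>) \<le> M $ i $ i"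
  shows "real (card P) \<le> real (rank M) * (2 + card P / (real k)\<^sup>2)"
proof (cases "P = {}")
  case False
  \<comment> \<open>Keeping the full index type, the submatrix is cut out by diagonal matrices on both sides;
      \<open>R\<close> also performs the normalisation.\<close>
  define L :: "real^'n^'n" where "L = (\<chi> i j. if i = j then of_bool (i \<in> P) else 0)"
  define R :: "real^'n^'n" where "R = (\<chi> i j. if i = j then of_bool (i \<in> P) / M $ i $ i else 0)"
  define S where "S = L ** M ** R"
  have S: "S $ j $ i = (if i \<in> P \<and> j \<in> P then M $ j $ i / M $ i $ i else 0)" for i j
    by (auto simp: S_def L_def R_def matrix_matrix_mult_def if_distrib[of "\<lambda>x. x * _"]
        if_distrib[of "\<lambda>x. _ * x"] cong: if_cong)
  have "trace S = (\<Sum>i\<in>UNIV. of_bool (i \<in> P))"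
    unfolding trace_def
  proof (rule sum.cong)
    show "S $ i $ i = of_bool (i \<in> P)" for i
      using diag[of i] by (cases "i \<in> P") (simp_all add: S)
  qed simp
  then have tr: "trace S = card P"
    by simp
  have col: "(norm (column i S))\<^sup>2 \<le> 2 + card P / (real k)\<^sup>2" if i: "i \<in> P" for i
  proof -
    have "(norm (column i S))\<^sup>2 = (\<Sum>j\<in>UNIV. (S $ j $ i)\<^sup>2)"
      by (simp add: norm_vec_def L2_set_def column_def sum_nonneg)
    also have "\<dots> = (\<Sum>j\<in>P. (S $ j $ i)\<^sup>2)"
      by (rule sum.mono_neutral_right) (auto simp: S)
    also have "\<dots> = (S $ i $ i)\<^sup>2 + (\<Sum>j\<in>P - {i}. (S $ j $ i)\<^sup>2)"
      using i by (intro sum.remove) auto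
    also have "S $ i $ i = 1"
      using i diag[OF i] by (simp add: S)
    also have "(\<Sum>j\<in>P - {i}. (S $ j $ i)\<^sup>2) = (\<Sum>j\<in>P - {i}. \<bar>S $ j $ i\<bar>\<^sup>2)"
      by simp
    also have "\<dots> \<le> 1 + card (P - {i}) / (real k)\<^sup>2"
    proof (rule sum_squares_le_of_top_sums)
      fix T assume T: "T \<subseteq> P - {i}" "card T \<le> k"
      have "(\<Sum>j\<in>T. \<bar>S $ j $ i\<bar>) = (\<Sum>j\<in>T. \<bar>M $ j $ i\<bar>) / M $ i $ i"
        unfolding sum_divide_distrib using T i diag[OF i] by (intro sum.cong) (auto simp: S)
      also have "\<dots> \<le> 1"
        using dom[OF i T] diag[OF i] by simp
      finally show "(\<Sum>j\<in>T. \<bar>S $ j $ i\<bar>) \<le> 1" .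
    qed (use \<open>k \<ge> 1\<close> in auto)
    also have "real (card (P - {i})) \<le> real (card P)"
      by (simp add: card_mono)
    finally show ?thesis
      by (simp add: divide_right_mono)
  qed
  have "rank S \<le> rank M"
    unfolding S_def using rank_mul_le_left[of "L ** M" R] rank_mul_le_right[of L M] by linarith
  have "(real (card P))\<^sup>2 \<le> real (rank S) * (\<Sum>i\<in>UNIV. (norm (column i S))\<^sup>2)"
    using trace_square_le_rank[of S] by (simp add: tr)
  also have "\<dots> \<le> real (rank M) * (\<Sum>i\<in>UNIV. (norm (column i S))\<^sup>2)"
    using \<open>rank S \<le> rank M\<close> by (intro mult_right_mono sum_nonneg) auto
  also have "(\<Sum>i\<in>UNIV. (norm (column i S))\<^sup>2) = (\<Sum>i\<in>P. (norm (column i S))\<^sup>2)"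
    by (rule sum.mono_neutral_right) (auto simp: S column_def zero_vec_def[symmetric])
  also have "real (rank M) * \<dots> \<le> real (rank M) * (\<Sum>i\<in>P. 2 + card P / (real k)\<^sup>2)"
    using col by (intro mult_left_mono sum_mono) auto
  also have "\<dots> = real (card P) * (real (rank M) * (2 + card P / (real k)\<^sup>2))"
    by simp
  finally show ?thesis
    using False by (simp add: power2_eq_square card_gt_0_iff)
qed simp

section \<open>Columns under the sparsity condition\<close>

text \<open>
  The indicator vector of \<open>T\<close> is admissible in the maximum; the work is in checking that the set of
  competing values is bounded, so that its supremum is meaningful.
\<close>

lemma sum_le_norm_s1:
  fixes x :: "real^'n"
  assumes "card T \<le> s"
  shows "(\<Sum>j\<in>T. x $ j) \<le> norm_s1 s x"
  unfolding norm_s1_def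
proof (rule cSup_upper)
  let ?u = "(\<chi> j. of_bool (j \<in> T)) :: real^'n"
  have "?u \<bullet> x = (\<Sum>j\<in>T. x $ j)"
    by (simp add: inner_vec_def of_bool_def if_distrib[of "\<lambda>x. x * _"] sum.If_cases cong: if_cong)
  moreover have "infnorm ?u \<le> 1"
    unfolding infnorm_cart by (rule cSup_least) auto
  moreover have "(\<Sum>i\<in>UNIV. \<bar>?u $ i\<bar>) \<le> real s"
    using assms by simp
  ultimately show "(\<Sum>j\<in>T. x $ j) \<in> {u \<bullet> x |u. (\<Sum>i\<in>UNIV. \<bar>u $ i\<bar>) \<le> real s \<and> infnorm u \<le> 1}"
    unfolding mem_Collect_eq by (intro exI[of _ ?u]) simp
  show "bdd_above {u \<bullet> x |u. (\<Sum>i\<in>UNIV. \<bar>u $ i\<bar>) \<le> real s \<and> infnorm u \<le> 1}"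
  proof (rule bdd_aboveI)
    fix y assume "y \<in> {u \<bullet> x |u. (\<Sum>i\<in>UNIV. \<bar>u $ i\<bar>) \<le> real s \<and> infnorm u \<le> 1}"
    then obtain u where u: "y = u \<bullet> x" "infnorm u \<le> 1"
      by auto
    have "u $ j * x $ j \<le> \<bar>x $ j\<bar>" for j
    proof -
      have "\<bar>u $ j\<bar> \<le> 1"
        using component_le_infnorm_cart[of u j] u(2) by linarith
      then have "\<bar>u $ j * x $ j\<bar> \<le> \<bar>x $ j\<bar>"
        by (simp add: abs_mult mult_left_le_one_le)
      then show ?thesis
        by linarith
    qed
    then show "y \<le> (\<Sum>j\<in>UNIV. \<bar>x $ j\<bar>)"
      unfolding u(1) inner_vec_def by (intro sum_mono) simp
  qed
qed

text \<open>
  The number \<open>w\<close> cancels when the two bounds are added. On \<open>Pp\<close> the positive parts of \<open>x\<close> and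
  \<open>- x\<close> add up to \<open>|x|\<close>, which gives the bound \<open>(\<xi> + \<theta>\<xi>) / (1 + \<theta>\<xi>)\<close>, and off \<open>Pp\<close> the
  absolute values double, which gives \<open>\<xi> / (1 + \<xi>)\<close>; both are below 1. A set \<open>T\<close> meeting both
  classes would mix the two weights, hence the case distinction in the hypothesis.
\<close>

lemma sum_abs_lt_1_of_Phi_bounds:
  fixes x :: "real^'n"
  assumes "0 \<le> \<xi>" "\<xi> < 1" "\<theta> \<ge> 1" "card T \<le> s"
    and neg: "Phi Pp \<xi> \<theta> s (- x) + w \<le> \<xi>"
    and cases: "T \<subseteq> Pp \<and> Phi Pp \<xi> \<theta> s x - w \<le> \<theta> * \<xi> \<or> T \<inter> Pp = {} \<and> Phi Pp \<xi> \<theta> s x - w \<le> \<xi>"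
  shows "(\<Sum>j\<in>T. \<bar>x $ j\<bar>) < 1"
proof -
  have sum_le: "(\<Sum>j\<in>T. D_op Pp \<xi> \<theta> x $ j + D_op Pp \<xi> \<theta> (- x) $ j) \<le> Phi Pp \<xi> \<theta> s x + Phi Pp \<xi> \<theta> s (- x)"
    unfolding Phi_def sum.distrib using assms(4) by (intro add_mono sum_le_norm_s1)
  from cases show ?thesis
  proof (elim disjE conjE)
    assume T: "T \<subseteq> Pp" and pos: "Phi Pp \<xi> \<theta> s x - w \<le> \<theta> * \<xi>"
    have "(\<Sum>j\<in>T. D_op Pp \<xi> \<theta> x $ j + D_op Pp \<xi> \<theta> (- x) $ j) = (\<Sum>j\<in>T. (1 + \<theta> * \<xi>) * \<bar>x $ j\<bar>)"
      using T by (intro sum.cong) (auto simp: D_op_def max_def abs_if)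
    then have "(1 + \<theta> * \<xi>) * (\<Sum>j\<in>T. \<bar>x $ j\<bar>) \<le> \<xi> + \<theta> * \<xi>"
      using sum_le pos neg by (simp add: sum_distrib_left)
    also have "\<dots> < (1 + \<theta> * \<xi>) * 1"
      using \<open>\<xi> < 1\<close> by simp
    finally show ?thesis
      by (rule mult_less_cancel_left_pos[THEN iffD1, rotated]) (use assms(1,3) in \<open>simp add: add_pos_nonneg\<close>)
  next
    assume T: "T \<inter> Pp = {}" and pos: "Phi Pp \<xi> \<theta> s x - w \<le> \<xi>"
    have "(\<Sum>j\<in>T. D_op Pp \<xi> \<theta> x $ j + D_op Pp \<xi> \<theta> (- x) $ j) = (\<Sum>j\<in>T. (2 * (1 + \<xi>)) * \<bar>x $ j\<bar>)"
      using T by (intro sum.cong) (auto simp: D_op_def)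
    then have "(2 * (1 + \<xi>)) * (\<Sum>j\<in>T. \<bar>x $ j\<bar>) \<le> 2 * \<xi>"
      using sum_le pos neg by (simp add: sum_distrib_left)
    also have "\<dots> < (2 * (1 + \<xi>)) * 1"
      by simp
    finally show ?thesis
      by (rule mult_less_cancel_left_pos[THEN iffD1, rotated]) (use assms(1) in simp)
  qed
qed

section \<open>The bound on the sparsity level\<close>

theorem proposition5p1:
  fixes A :: "real^'n^'m"
    and N :: "real^'m \<Rightarrow> real"
    and Pp Pn :: "'n set"
    and \<xi> \<theta> \<rho> \<sigma> :: real
    and s :: nat
  assumes "real CARD('n) > 2 * (2 * sqrt (2 * real CARD('m)) + 1)^2"
    and "Pp \<inter> Pn = {}" and "Pp \<union> Pn = UNIV"
    and "is_norm N"
    and "0 \<le> \<xi>" and "\<xi> < 1"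
    and "\<theta> \<ge> 1"
    and "\<sigma> \<ge> 0" and "\<rho> \<ge> 0"
    and "s \<ge> 1"
    and "VSG N Pp s \<xi> \<theta> \<rho> \<sigma> A"
  shows "real s \<le> 2 * sqrt (2 * real CARD('m)) + 1"
proof (rule ccontr)
  let ?m = "real CARD('m)"
  \<comment> \<open>One of the \<open>s\<close> entries in each column is spent on the diagonal.\<close>
  define k where "k = s - 1"
  assume "\<not> ?thesis"
  moreover have "real k = real s - 1"
    using \<open>s \<ge> 1\<close> by (simp add: k_def)
  ultimately have k: "2 * sqrt (2 * ?m) < real k"
    by simp
  have "(2 * sqrt (2 * ?m))\<^sup>2 < (real k)\<^sup>2"
    using k by (intro power_strict_mono) auto
  then have k2: "8 * ?m < (real k)\<^sup>2"
    by (simp add: power_mult_distrib)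
  have "k \<ge> 1"
    using k2 by (cases k) auto
  obtain Y v where VSG:
      "\<And>i. Phi Pp \<xi> \<theta> s (- C_col Y A i) + (transpose A *v v) $ i \<le> \<xi>"
      "\<And>i. i \<notin> Pp \<Longrightarrow> Phi Pp \<xi> \<theta> s (C_col Y A i) - (transpose A *v v) $ i \<le> \<xi>"
      "\<And>i. i \<in> Pp \<Longrightarrow> Phi Pp \<xi> \<theta> s (C_col Y A i) - (transpose A *v v) $ i \<le> \<theta> * \<xi>"
    using assms(11) unfolding VSG_def by blast
  define M where "M = transpose Y ** A"
  have C: "C_col Y A i $ j = of_bool (i = j) - M $ j $ i" for i j
    by (simp add: C_col_def M_def column_def mat_def)
  have "card Pp + card Pn = CARD('n)"
    using assms(2,3) by (metis card_Un_disjoint finite)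
  then have "CARD('n) \<le> 2 * card Pp \<or> CARD('n) \<le> 2 * card Pn"
    by linarith
  then obtain P where P: "P = Pp \<or> P = Pn" "CARD('n) \<le> 2 * card P"
    by blast
  have top: "(\<Sum>j\<in>T. \<bar>C_col Y A i $ j\<bar>) < 1" if "i \<in> P" "T \<subseteq> P" "card T \<le> s" for i T
  proof (rule sum_abs_lt_1_of_Phi_bounds[OF assms(5,6,7) that(3) VSG(1)])
    show "T \<subseteq> Pp \<and> Phi Pp \<xi> \<theta> s (C_col Y A i) - (transpose A *v v) $ i \<le> \<theta> * \<xi> \<or>
          T \<inter> Pp = {} \<and> Phi Pp \<xi> \<theta> s (C_col Y A i) - (transpose A *v v) $ i \<le> \<xi>"
    proof (cases "P = Pp")
      case True
      then show ?thesis using that VSG(3)[of i] by blast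
    next
      case False
      then have "P = Pn" using P(1) by blast
      then show ?thesis using that VSG(2)[of i] assms(2) by blast
    qed
  qed
  have dom: "(\<Sum>j\<in>T. \<bar>M $ j $ i\<bar>) < M $ i $ i" if i: "i \<in> P" and T: "T \<subseteq> P - {i}" "card T \<le> k" for i T
  proof -
    have "i \<notin> T" "card (insert i T) \<le> s"
      using T card_insert_if[of T i] \<open>s \<ge> 1\<close> by (auto simp: k_def)
    then have "\<bar>C_col Y A i $ i\<bar> + (\<Sum>j\<in>T. \<bar>C_col Y A i $ j\<bar>) < 1"
      using top[of i "insert i T"] i T by auto
    moreover have "(\<Sum>j\<in>T. \<bar>C_col Y A i $ j\<bar>) = (\<Sum>j\<in>T. \<bar>M $ j $ i\<bar>)"
      using \<open>i \<notin> T\<close> by (intro sum.cong) (auto simp: C)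
    \<comment> \<open>Here \<open>1 - |1 - M\<^sub>i\<^sub>i| \<le> M\<^sub>i\<^sub>i\<close> turns closeness to 1 into dominance over the column.\<close>
    ultimately show ?thesis
      by (simp add: C abs_if split: if_splits)
  qed
  have "real (rank M) \<le> ?m"
    using rank_mul_le_left[of "transpose Y" A] rank_bound[of "transpose Y"] by (simp add: M_def)
  have "real (card P) \<le> real (rank M) * (2 + card P / (real k)\<^sup>2)"
  proof (rule card_le_rank_if_columns_dominated[OF \<open>k \<ge> 1\<close>])
    show "0 < M $ i $ i" if "i \<in> P" for i
      using dom[OF that, of "{}"] by simp
  qed (use dom in \<open>auto intro: less_imp_le\<close>)
  also have "\<dots> \<le> ?m * (2 + card P / (8 * ?m))"
    using \<open>real (rank M) \<le> ?m\<close> \<open>k \<ge> 1\<close> k2 by (intro mult_mono add_left_mono divide_left_mono) auto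
  also have "\<dots> = 2 * ?m + card P / 8"
    by (simp add: field_simps)
  finally have "7 * real (card P) \<le> 16 * ?m"
    by simp
  moreover have "8 * ?m < real (card P)"
  proof -
    have "(2 * sqrt (2 * ?m))\<^sup>2 \<le> (2 * sqrt (2 * ?m) + 1)\<^sup>2"
      by (intro power_mono) auto
    then have "8 * ?m \<le> (2 * sqrt (2 * ?m) + 1)\<^sup>2"
      by (simp add: power_mult_distrib)
    with assms(1) P(2) show ?thesis
      by linarith
  qed
  ultimately show False
    by linarith
qed

end
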